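(* Let $\chi_1$ and $\chi_2$ be non-principal even primitive Dirichlet characters modulo $p$ and $q$ respectively, and let $a,x>0$ with $\frac{a^2 pq x}{16 \pi^2}\notin\mathbb{Z}_{>0}$. Then \begin{align*} \sum_{n=1}^\infty d_{\chi_1,\chi_2}(n) K_0(a\sqrt{nx})= \frac{a^2pq\, x}{32 \pi^4} \tau( \chi _1)\tau(\chi_2) \sum_{n=1}^\infty d_{\bar{\chi}_1,\bar{\chi}_2}(n) \frac{\log \left(\frac{16\pi^2 n}{a^2pqx} \right) }{n^2-\left(\frac{a^2pqx}{16\pi^2 } \right)^2}. \end{align*}
   Context: $d_{\chi_1,\chi_2}(n)=\sum_{d\mid n}\chi_1(d)\chi_2(n/d)$. $\tau(\chi)=\sum_{h=1}^q\chi(h)e^{2\pi i h/q}$ is the Gauss sum, and $K_0$ the modified Bessel function of the second kind of order $0$. *)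

theory Defs
  imports "HOL-Analysis.Analysis" "HOL-Number_Theory.Number_Theory"
begin

definition dirichlet_character :: "nat \<Rightarrow> (nat \<Rightarrow> complex) \<Rightarrow> bool" where
  "dirichlet_character q chi \<longleftrightarrow>
     q > 0 \<and> (\<forall>n. chi (n + q) = chi n) \<and> (\<forall>m n. chi (m * n) = chi m * chi n) \<and>
     chi 1 = 1 \<and> (\<forall>n. chi n \<noteq> 0 \<longleftrightarrow> coprime n q)"

definition principal_character :: "nat \<Rightarrow> (nat \<Rightarrow> complex) \<Rightarrow> bool" where
  "principal_character q chi \<longleftrightarrow> (\<forall>n. coprime n q \<longrightarrow> chi n = 1)"

text \<open>Primitive: no proper divisor d of q is an induced modulus, i.e. for every proper
  divisor d of q there is n coprime to q with n = 1 mod d and chi n \<noteq> 1.\<close>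
definition primitive_character :: "nat \<Rightarrow> (nat \<Rightarrow> complex) \<Rightarrow> bool" where
  "primitive_character q chi \<longleftrightarrow>
     dirichlet_character q chi \<and>
     (\<forall>d. d dvd q \<and> d < q \<longrightarrow> (\<exists>n. coprime n q \<and> [n = 1] (mod d) \<and> chi n \<noteq> 1))"

text \<open>Even character: chi(-1) = 1, where -1 is represented by q - 1.\<close>
definition even_character :: "nat \<Rightarrow> (nat \<Rightarrow> complex) \<Rightarrow> bool" where
  "even_character q chi \<longleftrightarrow> chi (q - 1) = 1"

definition twisted_divisor :: "(nat \<Rightarrow> complex) \<Rightarrow> (nat \<Rightarrow> complex) \<Rightarrow> nat \<Rightarrow> complex" where
  "twisted_divisor chi1 chi2 n = (\<Sum>d | d dvd n. chi1 d * chi2 (n div d))"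

definition gauss_sum :: "nat \<Rightarrow> (nat \<Rightarrow> complex) \<Rightarrow> complex" where
  "gauss_sum q chi = (\<Sum>h=1..q. chi h * exp (2 * of_real pi * \<i> * of_nat h / of_nat q))"

text \<open>Modified Bessel function of the second kind of order 0, for x > 0:
  K_0(x) = integral_0^\<infinity> exp(-x cosh t) dt.\<close>
definition bessel_K0 :: "real \<Rightarrow> real" where
  "bessel_K0 x = (LINT t:{0..}|lborel. exp (- x * cosh t))"

end

theory Submission
  imports Defs "HOL-Real_Asymp.Real_Asymp"
begin

text \<open>
  Put \<open>\<alpha> = a \<surd>x / 2\<close> and \<open>F\<^sub>i s = (\<Sum>m. \<chi>\<^sub>i m * exp (- m s))\<close>. Both sides of the identity are evaluations of
  \<open>\<integral> F\<^sub>1 (\<alpha> exp s) F\<^sub>2 (\<alpha> exp (- s)) ds\<close> over the real line.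
  Expanding both factors termwise, a translation of \<open>s\<close> turns the integral belonging to \<open>(j, k)\<close> into
  \<open>2 K\<^sub>0 (2 \<alpha> \<surd>(j k))\<close>. On the other hand, Fourier inversion modulo \<open>q\<close> and the partial fraction
  expansion of the cotangent give
  \<open>F s = \<tau>(\<chi>) / q * (\<Sum>j. cnj (\<chi> j) * 2 s / (s\<^sup>2 + (2 \<pi> j / q)\<^sup>2))\<close> for an even primitive character,
  and after inserting this the integrals are elementary and produce the logarithms.
  All double series converge absolutely.
\<close>

subsection \<open>Fourier inversion for primitive characters\<close>

text \<open>The additive character modulo \<open>q\<close>. Its argument is a natural number, so
  negating a residue is written as multiplication by \<open>q - 1\<close>.\<close>

definition unity_root :: "nat \<Rightarrow> nat \<Rightarrow> complex" where
  "unity_root q k = exp (2 * of_real pi * \<i> * of_nat k / of_nat q)"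

lemma unity_root_add: "unity_root q (m + n) = unity_root q m * unity_root q n"
  by (simp add: unity_root_def exp_add [symmetric] add_divide_distrib distrib_left)

lemma unity_root_mult: "unity_root q (m * n) = unity_root q m ^ n"
  by (simp add: unity_root_def exp_of_nat_mult [symmetric] field_simps)

lemma unity_root_eq_1_iff:
  assumes "q > 0"
  shows "unity_root q n = 1 \<longleftrightarrow> q dvd n"
proof -
  have "unity_root q n = 1 \<longleftrightarrow> (\<exists>k::int. real n / real q = of_int k)"
    using assms by (simp add: unity_root_def exp_eq_1 field_simps)
  also have "\<dots> \<longleftrightarrow> (\<exists>k::int. int n = k * int q)"
  proof -
    have "real n / real q = of_int k \<longleftrightarrow> int n = k * int q" for k
    proof -
      have "real n / real q = of_int k \<longleftrightarrow> real n = of_int k * real q"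
        using assms by (simp add: field_simps)
      also have "\<dots> \<longleftrightarrow> real_of_int (int n) = real_of_int (k * int q)"
        by simp
      also have "\<dots> \<longleftrightarrow> int n = k * int q"
        by (rule of_int_eq_iff)
      finally show ?thesis .
    qed
    thus ?thesis by simp
  qed
  also have "\<dots> \<longleftrightarrow> int q dvd int n"
    by (auto simp: dvd_def mult.commute)
  finally show ?thesis by simp
qed

lemma unity_root_cong:
  assumes "[m = n] (mod q)"
  shows "unity_root q m = unity_root q n"
proof (cases "q = 0")
  case False
  have *: "unity_root q k = unity_root q (k mod q)" for k
  proof -
    have "unity_root q k = unity_root q (q * (k div q)) * unity_root q (k mod q)"
      by (simp add: unity_root_add [symmetric])
    thus ?thesis using False by (simp add: unity_root_eq_1_iff)
  qed
  show ?thesis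
    using assms *[of m] *[of n] by (simp add: cong_def)
qed (use assms in \<open>auto simp: unity_root_def\<close>)

lemma sum_unity_root:
  assumes "q > 0"
  shows "(\<Sum>h<q. unity_root q (n * h)) = (if q dvd n then of_nat q else 0)"
proof (cases "q dvd n")
  case True
  hence "unity_root q n = 1" using assms by (simp add: unity_root_eq_1_iff)
  with True show ?thesis by (simp add: unity_root_mult)
next
  case False
  hence "unity_root q n \<noteq> 1" using assms by (simp add: unity_root_eq_1_iff)
  moreover have "unity_root q n ^ q = 1"
    using unity_root_eq_1_iff[OF assms, of "n * q"] by (simp add: unity_root_mult)
  ultimately show ?thesis
    using False by (simp add: unity_root_mult geometric_sum)
qed

text \<open>Multiplication by a unit permutes the residues modulo \<open>q\<close>. This serves as
  the substitution \<open>h\<close> to \<open>n * h\<close> in character sums, and with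
  \<open>n = q - 1\<close> as the substitution of \<open>-h\<close> for \<open>h\<close>.\<close>

lemma sum_mult_coprime:
  fixes f :: "nat \<Rightarrow> 'a :: comm_monoid_add"
  assumes "q > 0" "coprime n q" and f: "\<And>k. f (k mod q) = f k"
  shows "(\<Sum>h<q. f (n * h)) = (\<Sum>h<q. f h)"
proof -
  have inj: "inj_on (\<lambda>h. n * h mod q) {..<q}"
  proof (rule inj_onI)
    fix i j assume ij: "i \<in> {..<q}" "j \<in> {..<q}" "n * i mod q = n * j mod q"
    hence "[n * i = n * j] (mod q)" by (simp add: cong_def)
    hence "[i = j] (mod q)" using assms(2) by (simp add: cong_mult_lcancel_nat)
    with ij show "i = j" by (simp add: cong_def)
  qed
  have "(\<lambda>h. n * h mod q) ` {..<q} = {..<q}"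
    by (rule endo_inj_surj[OF _ _ inj]) (use assms in auto)
  with inj have "bij_betw (\<lambda>h. n * h mod q) {..<q} {..<q}"
    by (simp add: bij_betw_def)
  from sum.reindex_bij_betw[OF this, of f] show ?thesis by (simp add: f)
qed

section \<open>Dirichlet characters and their Gauss sums\<close>

locale dirichlet_char =
  fixes q :: nat and chi :: "nat \<Rightarrow> complex"
  assumes char: "dirichlet_character q chi"
begin

lemma modulus_pos: "q > 0"
  and chi_add_modulus: "chi (n + q) = chi n"
  and chi_mult: "chi (m * n) = chi m * chi n"
  and chi_1: "chi 1 = 1"
  and chi_nz_iff: "chi n \<noteq> 0 \<longleftrightarrow> coprime n q"
  using char unfolding dirichlet_character_def by blast+

lemma chi_mod: "chi (n mod q) = chi n"
proof -
  have "chi (m + k * q) = chi m" for m k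
  proof (induction k)
    case (Suc k)
    thus ?case using chi_add_modulus[of "m + k * q"] by (simp add: algebra_simps)
  qed auto
  from this[of "n mod q" "n div q"] show ?thesis by simp
qed

lemma chi_cong: "[m = n] (mod q) \<Longrightarrow> chi m = chi n"
  by (metis chi_mod cong_def)

lemma chi_power: "chi (n ^ k) = chi n ^ k"
  by (induction k) (auto simp: chi_mult chi_1 [simplified])

text \<open>Euler's theorem makes \<open>chi n\<close> a root of unity.\<close>

lemma norm_chi_coprime:
  assumes "coprime n q"
  shows "norm (chi n) = 1"
proof -
  have "chi n ^ totient q = 1"
    using chi_cong[OF euler_theorem[OF assms]] by (simp add: chi_power chi_1 [simplified])
  hence "norm (chi n) ^ totient q = 1"
    by (metis norm_one norm_power)
  moreover have "totient q \<noteq> 0" using modulus_pos by simp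
  ultimately show ?thesis by (metis norm_ge_zero power_eq_1_iff abs_norm_cancel real_norm_def)
qed

lemma norm_chi_le: "norm (chi n) \<le> 1"
  using norm_chi_coprime[of n] chi_nz_iff[of n] by (cases "coprime n q") auto

lemma chi_times_cnj: "coprime n q \<Longrightarrow> chi n * cnj (chi n) = 1"
  using norm_chi_coprime[of n] by (simp add: complex_norm_square [symmetric])

lemma gauss_sum_altdef: "gauss_sum q chi = (\<Sum>k<q. chi k * unity_root q k)"
proof -
  let ?f = "\<lambda>k. chi k * unity_root q k"
  have "gauss_sum q chi = sum ?f {1..q}"
    by (simp add: gauss_sum_def unity_root_def)
  also have "\<dots> = sum ?f ({1..<q} \<union> {q})"
    using modulus_pos by (intro sum.cong) auto
  also have "\<dots> = sum ?f {1..<q} + ?f q"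
    by (subst sum.union_disjoint) auto
  also have "?f q = ?f 0"
    using chi_cong[of q 0] unity_root_cong[of q 0 q] by (simp add: cong_def)
  also have "sum ?f {1..<q} + ?f 0 = sum ?f ({0} \<union> {1..<q})"
    by (subst sum.union_disjoint) auto
  also have "\<dots> = sum ?f {..<q}"
    using modulus_pos by (intro sum.cong) auto
  finally show ?thesis .
qed

end

locale primitive_char = dirichlet_char +
  assumes prim: "primitive_character q chi"
begin

text \<open>Separability of the Gauss sum; primitivity enters here. For \<open>h\<close> coprime to
  \<open>q\<close>, substitute \<open>h * k\<close> for \<open>k\<close>. Otherwise both sides
  vanish: with \<open>g = gcd h q\<close>, primitivity tested at the divisor \<open>q div g\<close>
  supplies a unit \<open>n\<close> with \<open>chi n \<noteq> 1\<close> and \<open>n * h\<close>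
  congruent to \<open>h\<close>, and substituting \<open>n * k\<close> for \<open>k\<close>
  multiplies the sum by \<open>chi n\<close>.\<close>

lemma sum_chi_unity_root:
  "(\<Sum>k<q. chi k * unity_root q (k * h)) = cnj (chi h) * gauss_sum q chi"
proof (cases "coprime h q")
  case True
  have "(\<Sum>k<q. chi (h * k) * unity_root q (h * k)) = (\<Sum>k<q. chi k * unity_root q k)"
    using sum_mult_coprime[OF modulus_pos True, of "\<lambda>k. chi k * unity_root q k"]
    by (simp add: chi_mod unity_root_cong[of "k mod q" k q for k])
  hence "chi h * (\<Sum>k<q. chi k * unity_root q (k * h)) = gauss_sum q chi"
    by (simp add: gauss_sum_altdef sum_distrib_left chi_mult mult_ac)
  hence "chi h * cnj (chi h) * (\<Sum>k<q. chi k * unity_root q (k * h)) = cnj (chi h) * gauss_sum q chi"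
    by (simp add: mult_ac)
  thus ?thesis using chi_times_cnj[OF True] by simp
next
  case False
  define g where "g = gcd h q"
  define d where "d = q div g"
  have "g \<noteq> 1" "g \<noteq> 0" using False modulus_pos by (metis g_def coprime_iff_gcd_eq_1, simp add: g_def)
  hence g: "g > 1" "g dvd q" "g dvd h"
    by (linarith, simp_all add: g_def)
  have q: "q = g * d" using g by (simp add: d_def)
  have "d dvd q" "d < q" using q g(1) modulus_pos by auto
  then obtain n where n: "coprime n q" "[n = 1] (mod d)" "chi n \<noteq> 1"
    using prim unfolding primitive_character_def by blast
  obtain h' where h': "h = g * h'" using g by auto
  \<comment> \<open>Multiplying by \<open>g\<close> raises the modulus from \<open>d\<close> to
    \<open>g * d = q\<close>; the cofactor \<open>h'\<close> then completes
    \<open>h\<close>.\<close>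
  have "[g * n = g * 1] (mod (g * d))"
    using n(2) by (simp add: cong_def mult_mod_right [symmetric])
  hence nh: "[n * h = h] (mod q)"
    unfolding q h' using cong_mult[of "g * n" "g * 1" "g * d" h' h'] by (simp add: mult_ac)
  let ?S = "\<Sum>k<q. chi k * unity_root q (k * h)"
  have "?S = (\<Sum>k<q. chi (n * k) * unity_root q (n * k * h))"
  proof (rule sum_mult_coprime[OF modulus_pos n(1), symmetric])
    fix k
    have "unity_root q (k mod q * h) = unity_root q (k * h)"
      by (rule unity_root_cong) (simp add: cong_def mod_mult_left_eq)
    thus "chi (k mod q) * unity_root q (k mod q * h) = chi k * unity_root q (k * h)"
      by (simp add: chi_mod)
  qed
  also have "\<dots> = chi n * ?S"
  proof -
    have "unity_root q (n * k * h) = unity_root q (k * h)" for k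
      by (rule unity_root_cong) (use cong_mult[OF cong_refl[of k] nh] in \<open>simp add: mult_ac\<close>)
    thus ?thesis by (simp add: sum_distrib_left chi_mult mult_ac)
  qed
  finally have "?S = 0" using n(3) by simp
  thus ?thesis using False chi_nz_iff[of h] by auto
qed

text \<open>Replacing \<open>cnj (chi h) * gauss_sum q chi\<close> by its defining sum over
  \<open>k\<close> and summing over \<open>h\<close> first, orthogonality of the roots of unity
  leaves only \<open>k\<close> congruent to \<open>-m\<close>. Evenness turns the value there into
  \<open>chi m\<close>.\<close>

lemma fourier_inversion:
  assumes "even_character q chi"
  shows "of_nat q * chi m = gauss_sum q chi * (\<Sum>h<q. cnj (chi h) * unity_root q (m * h))"
proof -
  \<comment> \<open>The residue of \<open>-m\<close>.\<close>
  define k0 where "k0 = (q - 1) * m mod q"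
  have k0: "k0 < q" using modulus_pos by (simp add: k0_def)
  have "chi k0 = chi m"
    using assms by (simp add: k0_def chi_mod chi_mult even_character_def)
  have iff: "q dvd k + m \<longleftrightarrow> k = k0" if "k < q" for k
  proof -
    have "(q - 1) * m + m = q * m"
      using modulus_pos by (simp add: algebra_simps)
    hence "[k0 + m = 0] (mod q)"
      by (simp add: k0_def cong_def mod_add_left_eq)
    hence "q dvd k + m \<longleftrightarrow> [k + m = k0 + m] (mod q)"
      by (simp add: cong_def mod_eq_0_iff_dvd)
    also have "\<dots> \<longleftrightarrow> [k = k0] (mod q)"
      by (rule cong_add_rcancel_nat)
    finally show ?thesis using that k0 by (simp add: cong_def)
  qed
  have "gauss_sum q chi * (\<Sum>h<q. cnj (chi h) * unity_root q (m * h)) =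
        (\<Sum>h<q. (cnj (chi h) * gauss_sum q chi) * unity_root q (m * h))"
    by (simp add: sum_distrib_left mult_ac)
  also have "\<dots> = (\<Sum>h<q. \<Sum>k<q. chi k * unity_root q ((k + m) * h))"
    unfolding sum_chi_unity_root [symmetric] sum_distrib_right distrib_right unity_root_add mult.assoc ..
  also have "\<dots> = (\<Sum>k<q. chi k * (\<Sum>h<q. unity_root q ((k + m) * h)))"
    by (subst sum.swap) (simp add: sum_distrib_left)
  also have "\<dots> = (\<Sum>k<q. if k = k0 then of_nat q * chi k else 0)"
    by (intro sum.cong) (auto simp: sum_unity_root modulus_pos iff simp del: add_mult_distrib)
  also have "\<dots> = of_nat q * chi m"
    using k0 by (simp add: \<open>chi k0 = chi m\<close>)
  finally show ?thesis ..
qed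

end

subsection \<open>Partial fractions of the cotangent\<close>

text \<open>Differentiate both sides of the reflection formula for
  \<open>Gamma w * Gamma (1 - w)\<close> at \<open>z\<close>.\<close>

lemma Digamma_reflection_complex:
  fixes z :: complex
  assumes "z \<notin> \<int>"
  shows "Digamma (1 - z) - Digamma z = of_real pi * cot (of_real pi * z)"
proof -
  have nonpos: "z \<notin> \<int>\<^sub>\<le>\<^sub>0" "1 - z \<notin> \<int>\<^sub>\<le>\<^sub>0"
    using assms by (auto dest: nonpos_Ints_Int)
  have sin: "sin (of_real pi * z) \<noteq> 0"
  proof
    assume "sin (of_real pi * z) = 0"
    then obtain n :: int where "of_real pi * z = of_real (of_int n * pi)"
      by (auto simp: sin_eq_0)
    hence "z = of_int n" by simp
    with assms show False by auto
  qed
  let ?s = "sin (of_real pi * z)" and ?c = "cos (of_real pi * z)"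
  have "((\<lambda>w. Gamma w * Gamma (1 - w)) has_field_derivative
          Gamma z * Gamma (1 - z) * (Digamma z - Digamma (1 - z))) (at z)"
    using nonpos by (auto intro!: derivative_eq_intros simp: algebra_simps)
  also have "(\<lambda>w::complex. Gamma w * Gamma (1 - w)) = (\<lambda>w. of_real pi / sin (of_real pi * w))"
    by (rule ext) (rule Gamma_reflection_complex)
  finally have 1: "((\<lambda>w. of_real pi / sin (of_real pi * w)) has_field_derivative
          (of_real pi / ?s) * (Digamma z - Digamma (1 - z))) (at z)"
    by (simp add: Gamma_reflection_complex)
  have 2: "((\<lambda>w. of_real pi / sin (of_real pi * w)) has_field_derivative
          - (of_real pi * (of_real pi * ?c)) / (?s * ?s)) (at z)"
    using sin by (auto intro!: derivative_eq_intros)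
  have "(of_real pi / ?s) * (Digamma z - Digamma (1 - z)) = - (of_real pi * (of_real pi * ?c)) / (?s * ?s)"
    by (rule DERIV_unique[OF 1 2])
  hence "(of_real pi / ?s) * (Digamma (1 - z) - Digamma z) = (of_real pi / ?s) * (of_real pi * (?c / ?s))"
    by (simp add: algebra_simps)
  moreover have "of_real pi / ?s \<noteq> 0" using sin by simp
  ultimately show ?thesis unfolding cot_def mult_cancel_left by blast
qed

text \<open>Subtract the series of \<open>Digamma z\<close> from that of
  \<open>Digamma (1 - z)\<close>; the harmonic terms cancel. The result is the expansion over all
  integers, with \<open>k\<close> paired with \<open>-(k + 1)\<close>.\<close>

lemma cot_pfd_complex:
  fixes z :: complex
  assumes "z \<notin> \<int>"
  shows "(\<lambda>k. 1 / (z + of_nat k) - 1 / (of_nat (Suc k) - z)) sums (of_real pi * cot (of_real pi * z))"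
proof -
  have "z \<noteq> 0" "1 - z \<noteq> 0" using assms by auto
  from summable_Digamma[OF this(1), THEN summable_sums]
  have 1: "(\<lambda>k. inverse (of_nat (Suc k)) - inverse (z + of_nat k)) sums (Digamma z + euler_mascheroni)"
    by (simp add: Digamma_def)
  from summable_Digamma[OF \<open>1 - z \<noteq> 0\<close>, THEN summable_sums]
  have 2: "(\<lambda>k. inverse (of_nat (Suc k)) - inverse (1 - z + of_nat k)) sums (Digamma (1 - z) + euler_mascheroni)"
    by (simp add: Digamma_def)
  from sums_diff[OF 2 1] show ?thesis
    by (simp add: Digamma_reflection_complex[OF assms] inverse_eq_divide algebra_simps)
qed

lemma cot_shift: "cot (of_real pi * (z + 1)) = cot (of_real pi * z :: complex)"
  by (simp add: cot_def distrib_left sin_add cos_add sin_of_real cos_of_real)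

text \<open>Connects sums of geometric series with the cotangent. With
  \<open>E = exp (\<i> * pi * w)\<close>, Euler's formulas make the cotangent a rational function of
  \<open>E ^ 2\<close>.\<close>

lemma one_over_one_minus_exp:
  fixes w :: complex
  assumes "w \<notin> \<int>"
  shows "1 / (1 - exp (2 * of_real pi * \<i> * w)) = 1 / 2 + \<i> / 2 * cot (of_real pi * w)"
proof -
  define E where "E = exp (\<i> * (of_real pi * w))"
  have E: "exp (2 * of_real pi * \<i> * w) = E ^ 2"
    by (simp add: E_def exp_double [symmetric] mult_ac)
  have [simp]: "E \<noteq> 0" by (simp add: E_def)
  have "E ^ 2 \<noteq> 1"
  proof
    assume "E ^ 2 = 1"
    hence "exp (2 * of_real pi * \<i> * w) = 1" by (simp add: E)
    then obtain n :: int where "Re (2 * of_real pi * \<i> * w) = 0" "Im (2 * of_real pi * \<i> * w) = of_int (2 * n) * pi"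
      unfolding exp_eq_1 by auto
    hence "w = of_int n" by (simp add: complex_eq_iff)
    thus False using assms by auto
  qed
  have "exp (- (\<i> * (of_real pi * w))) = 1 / E"
    by (simp add: E_def exp_minus field_simps)
  hence "cot (of_real pi * w) = ((E + 1 / E) / 2) / ((E - 1 / E) / (2 * \<i>))"
    by (simp add: cot_def cos_exp_eq sin_exp_eq E_def)
  also have "\<dots> = \<i> * (E ^ 2 + 1) / (E ^ 2 - 1)"
    using \<open>E ^ 2 \<noteq> 1\<close> by (simp add: divide_simps power2_eq_square) (simp add: algebra_simps)?
  finally show ?thesis
    unfolding E using \<open>E ^ 2 \<noteq> 1\<close> by (simp add: divide_simps) (simp add: algebra_simps)?
qed

text \<open>The left side is the sum of \<open>2 s / (s^2 + (2 pi (n + a))^2)\<close> over all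
  integers \<open>n\<close>, where \<open>n = k\<close> and \<open>n = - Suc k\<close> are taken
  together. Each such term is a sum of two simple fractions, with poles at opposite points, so the
  cotangent expansions at \<sigma> + a and \<sigma> + (1 - a) combine to it.\<close>

lemma lorentz_pfd:
  fixes a s :: real
  assumes "s > 0"
  shows "(\<lambda>k. of_real (2 * s / (s\<^sup>2 + (2 * pi * (real k + a))\<^sup>2) +
                2 * s / (s\<^sup>2 + (2 * pi * (real (Suc k) - a))\<^sup>2)))
         sums (1 / (1 - exp (2 * of_real pi * \<i> * of_real a - of_real s)) +
               1 / (1 - exp (- 2 * of_real pi * \<i> * of_real a - of_real s)) - 1 :: complex)"
proof -
  \<comment> \<open>Chosen so that \<open>exp (2 * pi * \<i> * \<sigma>) = exp (- s)\<close>. It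
    lies off the real axis, so no real translate of it is an integer.\<close>
  define \<sigma> where "\<sigma> = \<i> * of_real (s / (2 * pi))"
  have im: "Im (\<sigma> + of_real r) > 0" for r using assms by (simp add: \<sigma>_def)
  have nint: "\<sigma> + of_real r \<notin> \<int>" for r
    using im[of r] by (metis Ints_cases Im_complex_of_real less_irrefl of_real_of_int_eq)
  have nz: "\<sigma> + of_real r \<noteq> 0" "\<sigma> - of_real r \<noteq> 0" for r
    using im[of r] im[of "-r"] by (metis zero_complex.sel(2) less_irrefl, force)
  have E1: "2 * of_real pi * \<i> * of_real a - of_real s = 2 * of_real pi * \<i> * (\<sigma> + of_real a)"
    by (simp add: \<sigma>_def complex_eq_iff)
  have E2: "- 2 * of_real pi * \<i> * of_real a - of_real s = 2 * of_real pi * \<i> * (\<sigma> + of_real (- a))"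
    by (simp add: \<sigma>_def complex_eq_iff)
  define c1 c2 where "c1 = of_real pi * cot (of_real pi * (\<sigma> + of_real a))"
    and "c2 = of_real pi * cot (of_real pi * (\<sigma> + of_real (1 - a)))"
  \<comment> \<open>The shift \<open>1 - a\<close> produces the right summation points,
    \<open>- a\<close> the right exponential; periodicity identifies the two cotangents.\<close>
  have c2: "c2 = of_real pi * cot (of_real pi * (\<sigma> + of_real (- a)))"
    using cot_shift[of "\<sigma> + of_real (- a)"] by (simp add: c2_def algebra_simps)
  have "(\<lambda>k. (1 / (\<sigma> + of_real a + of_nat k) - 1 / (of_nat (Suc k) - (\<sigma> + of_real a))) +
         (1 / (\<sigma> + of_real (1 - a) + of_nat k) - 1 / (of_nat (Suc k) - (\<sigma> + of_real (1 - a)))))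
         sums (c1 + c2)"
    unfolding c1_def c2_def by (intro sums_add cot_pfd_complex nint)
  hence sums: "(\<lambda>k. \<i> / (2 * of_real pi) * ((1 / (\<sigma> + of_real a + of_nat k) - 1 / (of_nat (Suc k) - (\<sigma> + of_real a))) +
         (1 / (\<sigma> + of_real (1 - a) + of_nat k) - 1 / (of_nat (Suc k) - (\<sigma> + of_real (1 - a))))))
         sums (\<i> / (2 * of_real pi) * (c1 + c2))"
    by (rule sums_mult)
  have pair: "\<i> / (2 * of_real pi) * (1 / (\<sigma> + of_real r) + 1 / (\<sigma> - of_real r)) =
         of_real (2 * s / (s\<^sup>2 + (2 * pi * r)\<^sup>2))" for r
  proof -
    have pos: "s\<^sup>2 + (2 * pi * r)\<^sup>2 > 0"
      using assms by (intro add_pos_nonneg) auto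
    have "(\<sigma> + of_real r) * (\<sigma> - of_real r) = - of_real ((s\<^sup>2 + (2 * pi * r)\<^sup>2) / (4 * pi\<^sup>2))"
      by (simp add: \<sigma>_def complex_eq_iff field_simps power2_eq_square)
    moreover have "1 / (\<sigma> + of_real r) + 1 / (\<sigma> - of_real r) = 2 * \<sigma> / ((\<sigma> + of_real r) * (\<sigma> - of_real r))"
      using nz[of r] by (simp add: divide_simps)
    ultimately have "\<i> / (2 * of_real pi) * (1 / (\<sigma> + of_real r) + 1 / (\<sigma> - of_real r)) =
       \<i> / (2 * of_real pi) * (2 * \<sigma> / (- of_real ((s\<^sup>2 + (2 * pi * r)\<^sup>2) / (4 * pi\<^sup>2))))"
      by simp
    also have "\<dots> = of_real ((s / (2 * pi\<^sup>2)) / ((s\<^sup>2 + (2 * pi * r)\<^sup>2) / (4 * pi\<^sup>2)))"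
      by (simp add: \<sigma>_def power2_eq_square)
    also have "(s / (2 * pi\<^sup>2)) / ((s\<^sup>2 + (2 * pi * r)\<^sup>2) / (4 * pi\<^sup>2)) = 2 * s / (s\<^sup>2 + (2 * pi * r)\<^sup>2)"
      using pos by (simp add: divide_simps)
    finally show ?thesis .
  qed
  have neg: "- (1 / (u - v)) = 1 / (v - u)" for u v :: complex
    by (metis minus_diff_eq minus_divide_right)
  have "\<i> / (2 * of_real pi) * ((1 / (\<sigma> + of_real a + of_nat k) - 1 / (of_nat (Suc k) - (\<sigma> + of_real a))) +
         (1 / (\<sigma> + of_real (1 - a) + of_nat k) - 1 / (of_nat (Suc k) - (\<sigma> + of_real (1 - a))))) =
        of_real (2 * s / (s\<^sup>2 + (2 * pi * (real k + a))\<^sup>2) +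
                2 * s / (s\<^sup>2 + (2 * pi * (real (Suc k) - a))\<^sup>2))" for k
  proof -
    have "(1 / (\<sigma> + of_real a + of_nat k) - 1 / (of_nat (Suc k) - (\<sigma> + of_real a))) +
         (1 / (\<sigma> + of_real (1 - a) + of_nat k) - 1 / (of_nat (Suc k) - (\<sigma> + of_real (1 - a)))) =
        (1 / (\<sigma> + of_real (real k + a)) + 1 / (\<sigma> - of_real (real k + a))) +
        (1 / (\<sigma> + of_real (real (Suc k) - a)) + 1 / (\<sigma> - of_real (real (Suc k) - a)))"
      using neg[of "of_nat (Suc k)" "\<sigma> + of_real a", symmetric]
        neg[of "of_nat (Suc k)" "\<sigma> + of_real (1 - a)", symmetric]
      by (simp add: algebra_simps)
    thus ?thesis
      by (simp only:) (subst distrib_left, simp only: pair, simp only: of_real_add)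
  qed
  with sums have "(\<lambda>k. of_real (2 * s / (s\<^sup>2 + (2 * pi * (real k + a))\<^sup>2) +
                2 * s / (s\<^sup>2 + (2 * pi * (real (Suc k) - a))\<^sup>2)))
         sums (\<i> / (2 * of_real pi) * (c1 + c2))"
    by (simp only:)
  also have "\<i> / (2 * of_real pi) * (c1 + c2) = 
     (1 / (1 - exp (2 * of_real pi * \<i> * of_real a - of_real s)) +
               1 / (1 - exp (- 2 * of_real pi * \<i> * of_real a - of_real s)) - 1 :: complex)"
    unfolding E1 E2 one_over_one_minus_exp[OF nint] c2 c1_def by (simp add: field_simps)
  finally show ?thesis .
qed

subsection \<open>Interchanging a double series with an integral\<close>

lemma norm_summable_imp_has_sum_suminf:
  fixes w :: "nat \<Rightarrow> 'a :: banach"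
  assumes "summable (\<lambda>n. norm (w n))"
  shows "(w has_sum suminf w) UNIV"
  by (rule norm_summable_imp_has_sum[OF assms summable_sums[OF summable_norm_cancel[OF assms]]])

text \<open>Enumerating the pairs by \<open>prod_decode\<close> reduces the claim to the termwise
  integration of an ordinary series; absolute convergence makes the result independent of the
  enumeration.\<close>

lemma has_sum_integral_nat_prod:
  fixes f :: "nat \<times> nat \<Rightarrow> 'a \<Rightarrow> 'b :: {banach, second_countable_topology}"
  assumes int: "\<And>i. integrable M (f i)"
    and pointwise: "\<And>x. (\<lambda>i. norm (f i x)) summable_on UNIV"
    and norms: "(\<lambda>i. \<integral>x. norm (f i x) \<partial>M) summable_on UNIV"
  shows "((\<lambda>i. \<integral>x. f i x \<partial>M) has_sum (\<integral>x. (\<Sum>\<^sub>\<infinity>i. f i x) \<partial>M)) UNIV"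
proof -
  let ?e = prod_decode
  have sum_pw: "summable (\<lambda>n. norm (f (?e n) x))" for x
    using pointwise[of x] summable_on_reindex_bij_betw[OF bij_prod_decode, of "\<lambda>i. norm (f i x)"]
    by (auto intro: summable_on_imp_summable)
  have sum_int: "summable (\<lambda>n. \<integral>x. norm (f (?e n) x) \<partial>M)"
    using norms summable_on_reindex_bij_betw[OF bij_prod_decode, of "\<lambda>i. \<integral>x. norm (f i x) \<partial>M"]
    by (auto intro: summable_on_imp_summable)
  have "(\<lambda>n. \<integral>x. f (?e n) x \<partial>M) sums (\<integral>x. (\<Sum>n. f (?e n) x) \<partial>M)"
    by (rule sums_integral) (use int sum_pw sum_int in auto)
  also have "(\<lambda>x. \<Sum>n. f (?e n) x) = (\<lambda>x. \<Sum>\<^sub>\<infinity>i. f i x)"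
  proof
    fix x
    have "((\<lambda>n. f (?e n) x) has_sum (\<Sum>n. f (?e n) x)) UNIV"
      by (rule norm_summable_imp_has_sum_suminf[OF sum_pw])
    hence "((\<lambda>i. f i x) has_sum (\<Sum>n. f (?e n) x)) UNIV"
      using has_sum_reindex_bij_betw[OF bij_prod_decode, of "\<lambda>i. f i x"] by simp
    thus "(\<Sum>n. f (?e n) x) = (\<Sum>\<^sub>\<infinity>i. f i x)"
      by (simp add: infsumI)
  qed
  finally have sums: "(\<lambda>n. \<integral>x. f (?e n) x \<partial>M) sums (\<integral>x. (\<Sum>\<^sub>\<infinity>i. f i x) \<partial>M)" .
  have "summable (\<lambda>n. norm (\<integral>x. f (?e n) x \<partial>M))"
    by (rule summable_comparison_test'[OF sum_int, of 0]) simp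
  hence "((\<lambda>n. \<integral>x. f (?e n) x \<partial>M) has_sum (\<integral>x. (\<Sum>\<^sub>\<infinity>i. f i x) \<partial>M)) UNIV"
    using sums by (rule norm_summable_imp_has_sum)
  thus ?thesis
    using has_sum_reindex_bij_betw[OF bij_prod_decode, of "\<lambda>i. \<integral>x. f i x \<partial>M"] by simp
qed

text \<open>The norms are summed row by row first. This gives some unconditional sum
  \<open>S\<close>, and computing \<open>S\<close> as an iterated sum shows that it is the
  product.\<close>

lemma
  fixes u v :: "nat \<Rightarrow> 'a :: {banach, real_normed_field}"
  assumes u: "summable (\<lambda>j. norm (u j))" and v: "summable (\<lambda>k. norm (v k))"
  shows abs_summable_on_mult_nat: "(\<lambda>(j, k). norm (u j * v k)) summable_on UNIV"
    and has_sum_mult_nat: "((\<lambda>(j, k). u j * v k) has_sum (\<Sum>j. u j) * (\<Sum>k. v k)) UNIV"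
proof -
  note hs = norm_summable_imp_has_sum_suminf
  have "(\<lambda>(j, k). norm (u j) * norm (v k)) summable_on (UNIV \<times> UNIV)"
  proof (rule summable_on_SigmaI)
    show "((\<lambda>k. case (j, k) of (j, k) \<Rightarrow> norm (u j) * norm (v k)) has_sum
            norm (u j) * (\<Sum>k. norm (v k))) UNIV" for j
      unfolding prod.case by (rule has_sum_cmult_right, rule hs) (use v in simp)
    show "(\<lambda>j. norm (u j) * (\<Sum>k. norm (v k))) summable_on UNIV"
      by (rule summable_on_cmult_left, rule has_sum_imp_summable, rule hs) (use u in simp)
  qed auto
  thus *: "(\<lambda>(j, k). norm (u j * v k)) summable_on UNIV"
    by (simp add: norm_mult)
  hence "(\<lambda>(j, k). u j * v k) summable_on UNIV"
    by - (rule abs_summable_summable, simp add: case_prod_unfold)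
  then obtain S where S: "((\<lambda>(j, k). u j * v k) has_sum S) UNIV"
    by (auto simp: summable_on_def)
  have "((\<lambda>j. u j * suminf v) has_sum S) UNIV"
  proof (rule has_sum_SigmaD)
    show "((\<lambda>(j, k). u j * v k) has_sum S) (UNIV \<times> UNIV)" using S by simp
    show "((\<lambda>k. case (j, k) of (j, k) \<Rightarrow> u j * v k) has_sum u j * suminf v) UNIV" for j
      unfolding prod.case by (rule has_sum_cmult_right[OF hs[OF v]])
  qed
  moreover have "((\<lambda>j. u j * suminf v) has_sum suminf u * suminf v) UNIV"
    using hs[OF u] by (rule has_sum_cmult_left)
  ultimately show "((\<lambda>(j, k). u j * v k) has_sum (\<Sum>j. u j) * (\<Sum>k. v k)) UNIV"
    using S has_sum_unique by blast
qed

section \<open>Regrouping double series along divisors\<close>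

text \<open>Pairs of positive integers with product \<open>Suc n\<close> correspond to the divisors
  of \<open>Suc n\<close>. Unconditional summation permits collecting the terms for each
  \<open>n\<close>, and then reading the outer sum as an ordinary series.\<close>

lemma twisted_divisor_sums:
  fixes c1 c2 :: "nat \<Rightarrow> complex" and \<phi> :: "nat \<Rightarrow> complex"
  assumes "((\<lambda>(j, k). c1 (Suc j) * c2 (Suc k) * \<phi> (Suc j * Suc k)) has_sum S) UNIV"
  shows "(\<lambda>n. twisted_divisor c1 c2 (Suc n) * \<phi> (Suc n)) sums S"
proof -
  let ?F = "\<lambda>(n, d). c1 d * c2 (Suc n div d) * \<phi> (Suc n)"
  let ?T = "SIGMA n:UNIV. {d. d dvd Suc n}"
  have "((\<lambda>(j, k). c1 (Suc j) * c2 (Suc k) * \<phi> (Suc j * Suc k)) has_sum S) UNIV \<longleftrightarrow>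
        (?F has_sum S) ?T"
  \<comment> \<open>The index \<open>n\<close> stands for the product \<open>Suc n\<close>, whereas
    \<open>d\<close> is the divisor itself; hence the uneven shifts by one.\<close>
  proof (rule has_sum_reindex_bij_witness[where j = "\<lambda>(j, k). (Suc j * Suc k - 1, Suc j)"
           and i = "\<lambda>(n, d). (d - 1, Suc n div d - 1)"])
    show "(case b of (n, d) \<Rightarrow> (d - 1, Suc n div d - 1)) \<in> UNIV" for b by simp
    fix b assume b: "b \<in> ?T"
    obtain n d where nd: "b = (n, d)" by force
    with b have "d dvd Suc n" by simp
    then obtain e where e: "Suc n = d * e" by blast
    hence pos: "d > 0" "e > 0" by (metis Zero_not_Suc mult_0 gr0I, metis Zero_not_Suc mult_0_right gr0I)
    have "Suc n div d = e" using e pos by simp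
    thus "(case case b of (n, d) \<Rightarrow> (d - 1, Suc n div d - 1) of (j, k) \<Rightarrow> (Suc j * Suc k - 1, Suc j)) = b"
      using pos e by (simp add: nd del: mult_Suc mult_Suc_right)
  next
    fix a :: "nat \<times> nat"
    obtain j k where jk: "a = (j, k)" by force
    have *: "Suc (Suc j * Suc k - 1) = Suc j * Suc k" by simp
    show "(case case a of (j, k) \<Rightarrow> (Suc j * Suc k - 1, Suc j) of (n, d) \<Rightarrow> (d - 1, Suc n div d - 1)) = a"
      unfolding jk prod.case * by (simp del: mult_Suc mult_Suc_right)
    show "(case a of (j, k) \<Rightarrow> (Suc j * Suc k - 1, Suc j)) \<in> ?T"
      unfolding jk prod.case mem_Sigma_iff mem_Collect_eq * by (intro conjI UNIV_I dvd_triv_left)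
    show "?F (case a of (j, k) \<Rightarrow> (Suc j * Suc k - 1, Suc j)) =
            (case a of (j, k) \<Rightarrow> c1 (Suc j) * c2 (Suc k) * \<phi> (Suc j * Suc k))"
      unfolding jk prod.case * by (simp del: mult_Suc mult_Suc_right)
  qed auto
  with assms have "(?F has_sum S) ?T" by simp
  hence "((\<lambda>n. twisted_divisor c1 c2 (Suc n) * \<phi> (Suc n)) has_sum S) UNIV"
  proof (rule has_sum_SigmaD)
    fix n :: nat
    have "((\<lambda>d. ?F (n, d)) has_sum (\<Sum>d | d dvd Suc n. ?F (n, d))) {d. d dvd Suc n}"
      by (rule has_sum_finite) simp
    thus "((\<lambda>d. ?F (n, d)) has_sum twisted_divisor c1 c2 (Suc n) * \<phi> (Suc n)) {d. d dvd Suc n}"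
      by (simp add: twisted_divisor_def sum_distrib_right)
  qed
  thus ?thesis by (rule has_sum_imp_sums)
qed

text \<open>The common scheme for both evaluations. The integrals must depend on the product of the
  indices only, so that the double series regroups into twisted divisor sums. The exponent
  \<open>-3/2\<close> is multiplicative in the indices and less than \<open>-1\<close>, so the bound
  splits into two convergent series. Nonnegativity of \<open>g\<close> and \<open>h\<close> lets
  \<phi> itself bound the integrals of the norms.\<close>

lemma twisted_divisor_sums_integral:
  fixes c1 c2 :: "nat \<Rightarrow> complex" and g h :: "nat \<Rightarrow> real \<Rightarrow> real" and \<phi> :: "nat \<Rightarrow> real"
  assumes c1: "\<And>n. norm (c1 n) \<le> 1" and c2: "\<And>n. norm (c2 n) \<le> 1"
    and nonneg: "\<And>j s. g j s \<ge> 0" "\<And>k s. h k s \<ge> 0"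
    and int: "\<And>j k. has_bochner_integral lborel (\<lambda>s. g j s * h k s) (\<phi> (Suc j * Suc k))"
    and summable: "\<And>s. summable (\<lambda>j. g j s)" "\<And>s. summable (\<lambda>k. h k s)"
    and bound: "\<And>n. n > 0 \<Longrightarrow> \<phi> n \<le> C * real n powr (-3/2)"
  shows "(\<lambda>n. twisted_divisor c1 c2 (Suc n) * of_real (\<phi> (Suc n))) sums
           (\<integral>s. (\<Sum>j. c1 (Suc j) * of_real (g j s)) * (\<Sum>k. c2 (Suc k) * of_real (h k s)) \<partial>lborel)"
proof -
  define f where "f = (\<lambda>(j, k) s. (c1 (Suc j) * of_real (g j s)) * (c2 (Suc k) * of_real (h k s)))"
  have f_alt: "f (j, k) s = c1 (Suc j) * c2 (Suc k) * of_real (g j s * h k s)" for j k s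
    by (simp add: f_def mult_ac)
  have int_f: "has_bochner_integral lborel (f (j, k)) (c1 (Suc j) * c2 (Suc k) * of_real (\<phi> (Suc j * Suc k)))" for j k
    unfolding f_alt by (intro has_bochner_integral_mult_right has_bochner_integral_of_real int)
  have sg: "summable (\<lambda>j. norm (c1 (Suc j) * of_real (g j s)))" for s
    by (rule summable_comparison_test'[OF summable(1)[of s], of 0])
       (use c1 nonneg in \<open>auto simp: norm_mult intro!: mult_left_le_one_le\<close>)
  have sh: "summable (\<lambda>k. norm (c2 (Suc k) * of_real (h k s)))" for s
    by (rule summable_comparison_test'[OF summable(2)[of s], of 0])
       (use c2 nonneg in \<open>auto simp: norm_mult intro!: mult_left_le_one_le\<close>)
  have norm_f: "(\<integral>s. norm (f (j, k) s) \<partial>lborel) \<le> norm (C * (real (Suc j) powr (-3/2) * real (Suc k) powr (-3/2)))" for j k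
  proof -
    have "(\<integral>s. norm (f (j, k) s) \<partial>lborel) = (\<integral>s. norm (c1 (Suc j) * c2 (Suc k)) * (g j s * h k s) \<partial>lborel)"
      by (rule Bochner_Integration.integral_cong) (auto simp: f_alt norm_mult abs_mult nonneg)
    also have "\<dots> = norm (c1 (Suc j) * c2 (Suc k)) * \<phi> (Suc j * Suc k)"
      using int[of j k] by (simp add: has_bochner_integral_iff)
    also have "\<dots> \<le> \<phi> (Suc j * Suc k)"
    proof (rule mult_left_le_one_le)
      have "0 \<le> (\<integral>s. g j s * h k s \<partial>lborel)"
        by (intro Bochner_Integration.integral_nonneg) (auto simp: nonneg)
      thus "0 \<le> \<phi> (Suc j * Suc k)" using int[of j k] by (simp add: has_bochner_integral_iff)
      show "norm (c1 (Suc j) * c2 (Suc k)) \<le> 1"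
        using mult_mono[OF c1[of "Suc j"] c2[of "Suc k"]] by (simp add: norm_mult)
    qed auto
    also have "\<dots> \<le> C * real (Suc j * Suc k) powr (-3/2)" by (rule bound) simp
    also have "\<dots> = C * (real (Suc j) powr (-3/2) * real (Suc k) powr (-3/2))"
      by (subst powr_mult [symmetric]) (simp_all del: mult_Suc mult_Suc_right of_nat_Suc)
    finally show ?thesis by simp
  qed
  have "((\<lambda>i. \<integral>s. f i s \<partial>lborel) has_sum (\<integral>s. (\<Sum>\<^sub>\<infinity>i. f i s) \<partial>lborel)) UNIV"
  proof (rule has_sum_integral_nat_prod)
    show "integrable lborel (f i)" for i
      using int_f[of "fst i" "snd i"] by (simp add: has_bochner_integral_iff)
    show "(\<lambda>i. norm (f i s)) summable_on UNIV" for s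
      using abs_summable_on_mult_nat[OF sg sh, of s s] by (simp add: f_def case_prod_unfold)
    have "summable (\<lambda>n. real n powr (-3/2))" by (simp add: summable_real_powr_iff)
    hence s: "summable (\<lambda>n. real (Suc n) powr (-3/2))" by (subst summable_Suc_iff)
    have "(\<lambda>(j, k). norm (real (Suc j) powr (-3/2) * real (Suc k) powr (-3/2))) summable_on UNIV"
      by (rule abs_summable_on_mult_nat) (use s in auto)
    from summable_on_cmult_right[OF this, of "\<bar>C\<bar>"]
    show "(\<lambda>i. \<integral>s. norm (f i s) \<partial>lborel) summable_on UNIV"
      by (rule summable_on_comparison_test)
         (use norm_f in \<open>auto simp: abs_mult case_prod_unfold simp del: of_nat_Suc\<close>)
  qed
  also have "(\<lambda>i. \<integral>s. f i s \<partial>lborel) = (\<lambda>(j, k). c1 (Suc j) * c2 (Suc k) * of_real (\<phi> (Suc j * Suc k)))"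
    using int_f by (auto simp: fun_eq_iff has_bochner_integral_iff)
  also have "(\<lambda>s. \<Sum>\<^sub>\<infinity>i. f i s) =
      (\<lambda>s. (\<Sum>j. c1 (Suc j) * of_real (g j s)) * (\<Sum>k. c2 (Suc k) * of_real (h k s)))"
    using has_sum_mult_nat[OF sg sh, THEN infsumI] by (auto simp: fun_eq_iff f_def case_prod_unfold)
  finally show ?thesis by (rule twisted_divisor_sums)
qed

subsection \<open>The two integrals\<close>

text \<open>From \<open>exp w \<ge> w ^ 3 / 6\<close> and
  \<open>cosh t ^ 3 \<ge> cosh t \<ge> exp t / 2\<close>. The third power is chosen because
  \<open>z\<close> will be a multiple of \<open>sqrt n\<close>, which gives the decay
  \<open>n powr (-3/2)\<close>.\<close>

lemma exp_neg_cosh_bound: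
  assumes "z > (0::real)"
  shows "exp (- z * cosh t) \<le> 12 / z ^ 3 * exp (- t)"
proof -
  have c1: "cosh t \<ge> 1" by (rule cosh_real_ge_1)
  hence pos: "z * cosh t > 0" using assms by simp
  have "(z * cosh t) ^ 3 / 6 \<le> (\<Sum>n<4. (z * cosh t) ^ n /\<^sub>R fact n)"
    using pos by (simp add: eval_nat_numeral)
  also have "\<dots> \<le> exp (z * cosh t)"
    unfolding exp_def using pos by (intro sum_le_suminf summable_exp_generic) auto
  finally have "exp (- (z * cosh t)) \<le> 6 / (z * cosh t) ^ 3"
    using pos by (auto simp: exp_minus divide_simps mult_ac simp del: power_mult_distrib)
  also have "\<dots> = 6 / z ^ 3 * (1 / cosh t ^ 3)" by (simp add: power_mult_distrib)
  also have "1 / cosh t ^ 3 \<le> 2 * exp (- t)"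
  proof -
    have "exp t / 2 \<le> cosh t" by (simp add: cosh_field_def)
    also have "\<dots> \<le> cosh t ^ 3" using c1 by (simp add: self_le_power)
    finally have "1 / cosh t ^ 3 \<le> 1 / (exp t / 2)"
      by (intro divide_left_mono) (use c1 in \<open>auto intro!: mult_pos_pos\<close>)
    thus ?thesis by (simp add: exp_minus field_simps)
  qed
  finally show ?thesis using assms by (simp add: divide_simps mult_left_mono)
qed

lemma has_bochner_integral_exp_neg_Ici:
  "has_bochner_integral lborel (\<lambda>t::real. indicator {0..} t *\<^sub>R exp (- t)) 1"
proof (rule has_bochner_integral_nn_integral)
  have "(\<integral>\<^sup>+t. ennreal (exp (- t)) * indicator {0..} t \<partial>lborel) = ennreal (0 - (- exp (- 0)))"
  proof (rule nn_integral_FTC_atLeast)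
    show "((\<lambda>t::real. - exp (- t)) \<longlongrightarrow> 0) at_top" by real_asymp
  qed (auto intro!: derivative_eq_intros)
  thus "(\<integral>\<^sup>+t. ennreal (indicator {0..} t *\<^sub>R exp (- t)) \<partial>lborel) = ennreal 1"
    by (simp add: indicator_mult_ennreal mult.commute nn_integral_set_ennreal)
qed auto

lemma
  assumes "z > 0"
  shows integrable_bessel_K0: "integrable lborel (\<lambda>t. indicator {0..} t *\<^sub>R exp (- z * cosh t))"
    and bessel_K0_le: "bessel_K0 z \<le> 12 / z ^ 3"
proof -
  have int: "integrable lborel (\<lambda>t. 12 / z ^ 3 * (indicator {0..} t *\<^sub>R exp (- t)) :: real)"
    using has_bochner_integral_exp_neg_Ici by (auto simp: has_bochner_integral_iff)
  have bnd: "indicator {0..} t *\<^sub>R exp (- z * cosh t) \<le> 12 / z ^ 3 * (indicator {0..} t *\<^sub>R exp (- t))" for t :: real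
    using exp_neg_cosh_bound[OF assms, of t] by (auto simp: indicator_def)
  show *: "integrable lborel (\<lambda>t. indicator {0..} t *\<^sub>R exp (- z * cosh t))"
    by (rule Bochner_Integration.integrable_bound[OF int])
       (use bnd assms in \<open>auto simp: cosh_field_def indicator_def\<close>)
  have "bessel_K0 z \<le> (\<integral>t. 12 / z ^ 3 * (indicator {0..} t *\<^sub>R exp (- t)) \<partial>lborel)"
    unfolding bessel_K0_def set_lebesgue_integral_def by (rule integral_mono[OF * int bnd])
  also have "\<dots> = 12 / z ^ 3"
    using has_bochner_integral_exp_neg_Ici by (simp add: has_bochner_integral_iff)
  finally show "bessel_K0 z \<le> 12 / z ^ 3" .
qed

text \<open>The defining integral over the half-line is doubled by evenness. Translating by
  \<open>ln (sqrt (u / v))\<close> then unbalances the two exponentials in \<open>cosh\<close>,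
  giving them the weights \<open>u\<close> and \<open>v\<close>.\<close>

lemma has_bochner_integral_bessel_K0:
  fixes \<alpha> u v :: real
  assumes "\<alpha> > 0" "u > 0" "v > 0"
  shows "has_bochner_integral lborel (\<lambda>s. exp (- u * (\<alpha> * exp s)) * exp (- v * (\<alpha> * exp (- s))))
           (2 * bessel_K0 (2 * \<alpha> * sqrt (u * v)))"
proof -
  define z where "z = 2 * \<alpha> * sqrt (u * v)"
  have z: "z > 0" using assms by (simp add: z_def)
  have "has_bochner_integral lborel (\<lambda>s. indicator {0..} s *\<^sub>R exp (- z * cosh s)) (bessel_K0 z)"
    using integrable_bessel_K0[OF z]
    by (simp add: has_bochner_integral_iff bessel_K0_def set_lebesgue_integral_def)
  hence "has_bochner_integral lborel (\<lambda>s. exp (- z * cosh s)) (2 *\<^sub>R bessel_K0 z)"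
    by (rule has_bochner_integral_even_function) simp
  hence 1: "has_bochner_integral lborel (\<lambda>s. exp (- z * cosh (ln (sqrt (u / v)) + 1 * s))) (2 *\<^sub>R bessel_K0 z /\<^sub>R \<bar>1\<bar>)"
    by (subst (asm) lborel_has_bochner_integral_real_affine_iff[of 1 _ _ "ln (sqrt (u / v))"]) simp_all
  have "- z * cosh (ln (sqrt (u / v)) + 1 * s) = - u * (\<alpha> * exp s) + - v * (\<alpha> * exp (- s))" for s
  proof -
    have "sqrt (u * v) * sqrt (u / v) = u" "sqrt (u * v) / sqrt (u / v) = v"
      using assms by (simp_all add: real_sqrt_mult [symmetric] real_sqrt_divide [symmetric])
    hence "z * (sqrt (u / v) * exp s + exp (- s) / sqrt (u / v)) = 2 * \<alpha> * (u * exp s + v * exp (- s))"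
      unfolding z_def by (smt (verit) distrib_left mult.assoc mult.commute times_divide_eq_right)
    thus ?thesis
      using assms by (simp add: cosh_field_def exp_add exp_diff exp_minus ln_div field_simps)
  qed
  with 1 show ?thesis by (simp add: z_def exp_add [symmetric])
qed

section \<open>The integral producing the logarithm\<close>

text \<open>The integrand is a rational function of \<open>exp (2 * s)\<close>, and partial
  fractions give the antiderivative \<open>F\<close>. Its denominator \<open>D\<close> is nonzero
  exactly because \<open>A * B\<close> differs from the square of \<alpha>.\<close>

lemma has_bochner_integral_lorentz_prod:
  fixes \<alpha> A B :: real
  assumes "\<alpha> > 0" "A > 0" "B > 0" and neq: "A * B \<noteq> \<alpha>\<^sup>2"
  shows "has_bochner_integral lborel
           (\<lambda>s. 2 * (\<alpha> * exp s) / ((\<alpha> * exp s)\<^sup>2 + A\<^sup>2) * (2 * (\<alpha> * exp (- s)) / ((\<alpha> * exp (- s))\<^sup>2 + B\<^sup>2)))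
           (4 * \<alpha>\<^sup>2 * ln (A * B / \<alpha>\<^sup>2) / ((A * B)\<^sup>2 - \<alpha> ^ 4))"
proof -
  define D where "D = (A * B)\<^sup>2 - \<alpha> ^ 4"
  have D: "D \<noteq> 0"
  proof
    assume "D = 0"
    hence "(A * B)\<^sup>2 = (\<alpha>\<^sup>2)\<^sup>2" by (simp add: D_def)
    hence "A * B = \<alpha>\<^sup>2" by (rule power2_eq_imp_eq) (use assms in auto)
    with neq show False by simp
  qed
  define F where "F = (\<lambda>s. 2 * \<alpha>\<^sup>2 / D * (ln (\<alpha>\<^sup>2 + B\<^sup>2 * exp (2 * s)) - ln (A\<^sup>2 + \<alpha>\<^sup>2 * exp (2 * s))))"
  define f where "f = (\<lambda>s. 4 * \<alpha>\<^sup>2 * exp (2 * s) / ((A\<^sup>2 + \<alpha>\<^sup>2 * exp (2 * s)) * (\<alpha>\<^sup>2 + B\<^sup>2 * exp (2 * s))))"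
  have pos: "\<alpha>\<^sup>2 + B\<^sup>2 * exp (2 * s) > 0" "A\<^sup>2 + \<alpha>\<^sup>2 * exp (2 * s) > 0" for s
    using assms by (auto intro!: add_pos_pos)
  have deriv: "(F has_real_derivative f s) (at s)" for s
  proof -
    have "(F has_real_derivative 2 * \<alpha>\<^sup>2 / D * (2 * B\<^sup>2 * exp (2 * s) / (\<alpha>\<^sup>2 + B\<^sup>2 * exp (2 * s)) -
             2 * \<alpha>\<^sup>2 * exp (2 * s) / (A\<^sup>2 + \<alpha>\<^sup>2 * exp (2 * s)))) (at s)"
      unfolding F_def using pos[of s] D by (auto intro!: derivative_eq_intros simp: mult_ac)
    also have "2 * B\<^sup>2 * exp (2 * s) / (\<alpha>\<^sup>2 + B\<^sup>2 * exp (2 * s)) -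
             2 * \<alpha>\<^sup>2 * exp (2 * s) / (A\<^sup>2 + \<alpha>\<^sup>2 * exp (2 * s)) =
             2 * exp (2 * s) * D / ((A\<^sup>2 + \<alpha>\<^sup>2 * exp (2 * s)) * (\<alpha>\<^sup>2 + B\<^sup>2 * exp (2 * s)))"
      using pos[of s]
      by (subst diff_frac_eq) (auto simp: D_def algebra_simps power2_eq_square power4_eq_xxxx)
    also have "2 * \<alpha>\<^sup>2 / D * (2 * exp (2 * s) * D / ((A\<^sup>2 + \<alpha>\<^sup>2 * exp (2 * s)) * (\<alpha>\<^sup>2 + B\<^sup>2 * exp (2 * s)))) = f s"
      using D by (simp add: f_def)
    finally show ?thesis .
  qed
  have lim1: "(F \<longlongrightarrow> 2 * \<alpha>\<^sup>2 / D * (ln (\<alpha>\<^sup>2) - ln (A\<^sup>2))) at_bot"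
  proof -
    have "((\<lambda>s::real. exp (2 * s)) \<longlongrightarrow> 0) at_bot" by real_asymp
    hence "(F \<longlongrightarrow> 2 * \<alpha>\<^sup>2 / D * (ln (\<alpha>\<^sup>2 + B\<^sup>2 * 0) - ln (A\<^sup>2 + \<alpha>\<^sup>2 * 0))) at_bot"
      unfolding F_def by (intro tendsto_intros) (use assms in auto)
    thus ?thesis by simp
  qed
  have lim2: "(F \<longlongrightarrow> 2 * \<alpha>\<^sup>2 / D * (ln (B\<^sup>2) - ln (\<alpha>\<^sup>2))) at_top"
  proof -
    \<comment> \<open>Both logarithms diverge at infinity. Subtracting \<open>2 * s\<close> from
      each leaves their difference unchanged and makes both converge.\<close>
    have F_eq: "F = (\<lambda>s. 2 * \<alpha>\<^sup>2 / D * (ln (\<alpha>\<^sup>2 * exp (- 2 * s) + B\<^sup>2) - ln (A\<^sup>2 * exp (- 2 * s) + \<alpha>\<^sup>2)))"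
    proof
      fix s
      have "ln (u * exp (- 2 * s) + v) = ln (u + v * exp (2 * s)) - 2 * s" if "u > 0" "v > 0" for u v :: real
      proof -
        have "u * exp (- 2 * s) + v = (u + v * exp (2 * s)) * exp (- 2 * s)"
          by (simp add: distrib_right mult.assoc exp_add [symmetric])
        moreover have "u + v * exp (2 * s) > 0" using that by (auto intro!: add_pos_pos)
        ultimately show ?thesis by (simp add: ln_mult)
      qed
      thus "F s = 2 * \<alpha>\<^sup>2 / D * (ln (\<alpha>\<^sup>2 * exp (- 2 * s) + B\<^sup>2) - ln (A\<^sup>2 * exp (- 2 * s) + \<alpha>\<^sup>2))"
        using assms by (simp add: F_def)
    qed
    have "((\<lambda>s::real. exp (- 2 * s)) \<longlongrightarrow> 0) at_top" by real_asymp
    hence "(F \<longlongrightarrow> 2 * \<alpha>\<^sup>2 / D * (ln (\<alpha>\<^sup>2 * 0 + B\<^sup>2) - ln (A\<^sup>2 * 0 + \<alpha>\<^sup>2))) at_top"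
      unfolding F_eq by (intro tendsto_intros) (use assms in auto)
    thus ?thesis by simp
  qed
  have cont: "isCont f s" for s
    unfolding f_def using pos[of s] by (auto intro!: continuous_intros)
  have nonneg: "f s \<ge> 0" for s
    unfolding f_def using pos[of s] by (intro divide_nonneg_pos mult_nonneg_nonneg mult_pos_pos) auto
  have "set_integrable lborel (einterval (-\<infinity>) \<infinity>) f"
       "(LBINT s=-\<infinity>..\<infinity>. f s) = 2 * \<alpha>\<^sup>2 / D * (ln (B\<^sup>2) - ln (\<alpha>\<^sup>2)) - 2 * \<alpha>\<^sup>2 / D * (ln (\<alpha>\<^sup>2) - ln (A\<^sup>2))"
    by (rule interval_integral_FTC_nonneg[of _ _ F];
        use deriv cont nonneg lim1 lim2 in \<open>simp add: ereal_tendsto_simps\<close>)+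
  moreover have "2 * \<alpha>\<^sup>2 / D * (ln (B\<^sup>2) - ln (\<alpha>\<^sup>2)) - 2 * \<alpha>\<^sup>2 / D * (ln (\<alpha>\<^sup>2) - ln (A\<^sup>2)) =
          4 * \<alpha>\<^sup>2 * ln (A * B / \<alpha>\<^sup>2) / D"
    using assms D by (simp add: ln_mult ln_div ln_realpow field_simps)
  ultimately have "has_bochner_integral lborel f (4 * \<alpha>\<^sup>2 * ln (A * B / \<alpha>\<^sup>2) / D)"
    by (simp add: has_bochner_integral_iff interval_lebesgue_integral_def set_lebesgue_integral_def
          set_integrable_def)
  also have "f = (\<lambda>s. 2 * (\<alpha> * exp s) / ((\<alpha> * exp s)\<^sup>2 + A\<^sup>2) * (2 * (\<alpha> * exp (- s)) / ((\<alpha> * exp (- s))\<^sup>2 + B\<^sup>2)))"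
  proof
    fix s :: real
    define E where "E = exp s"
    have E: "E > 0" "exp (- s) = 1 / E" "exp (2 * s) = E\<^sup>2"
      by (simp_all add: E_def exp_minus divide_inverse exp_double)
    have p1: "(\<alpha> * E)\<^sup>2 + A\<^sup>2 > 0" "\<alpha>\<^sup>2 + B\<^sup>2 * E\<^sup>2 > 0"
      using assms E(1) by (auto intro!: add_nonneg_pos add_pos_nonneg)
    have "2 * (\<alpha> * (1 / E)) / ((\<alpha> * (1 / E))\<^sup>2 + B\<^sup>2) = 2 * \<alpha> * E / (\<alpha>\<^sup>2 + B\<^sup>2 * E\<^sup>2)"
    proof -
      have "(\<alpha> * (1 / E))\<^sup>2 + B\<^sup>2 = (\<alpha>\<^sup>2 + B\<^sup>2 * E\<^sup>2) / E\<^sup>2"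
        using E(1) by (simp add: field_simps)
      thus ?thesis using E(1) p1 by (simp add: power2_eq_square)
    qed
    hence "2 * (\<alpha> * E) / ((\<alpha> * E)\<^sup>2 + A\<^sup>2) * (2 * (\<alpha> * (1 / E)) / ((\<alpha> * (1 / E))\<^sup>2 + B\<^sup>2)) =
          4 * \<alpha>\<^sup>2 * E\<^sup>2 / ((A\<^sup>2 + \<alpha>\<^sup>2 * E\<^sup>2) * (\<alpha>\<^sup>2 + B\<^sup>2 * E\<^sup>2))"
      by (simp add: power_mult_distrib add.commute power2_eq_square mult_ac)
    thus "f s = 2 * (\<alpha> * exp s) / ((\<alpha> * exp s)\<^sup>2 + A\<^sup>2) * (2 * (\<alpha> * exp (- s)) / ((\<alpha> * exp (- s))\<^sup>2 + B\<^sup>2))"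
      unfolding f_def E(2,3) E_def [symmetric] by simp
  qed
  finally show ?thesis by (simp add: D_def)
qed

text \<open>The quotient is of order \<open>ln n / n ^ 2\<close>, so its product with
  \<open>n powr (3/2)\<close> tends to 0. A convergent sequence is bounded, which covers the small
  \<open>n\<close> too.\<close>

lemma log_ratio_bound:
  fixes c \<alpha> :: real
  assumes "c > 0" "\<alpha> > 0"
  obtains C where "\<And>n. n > 0 \<Longrightarrow> 4 * \<alpha>\<^sup>2 * ln (c * real n / \<alpha>\<^sup>2) / ((c * real n)\<^sup>2 - \<alpha> ^ 4) \<le> C * real n powr (-3/2)"
proof -
  define \<phi> where "\<phi> = (\<lambda>n::nat. 4 * \<alpha>\<^sup>2 * ln (c * real n / \<alpha>\<^sup>2) / ((c * real n)\<^sup>2 - \<alpha> ^ 4))"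
  have "(\<lambda>n. \<phi> n * real n powr (3/2)) \<longlonglongrightarrow> 0"
    unfolding \<phi>_def using assms by real_asymp
  hence "Bseq (\<lambda>n. \<phi> n * real n powr (3/2))"
    using convergent_imp_Bseq convergentI by blast
  then obtain C where C: "\<And>n. \<bar>\<phi> n * real n powr (3/2)\<bar> \<le> C"
    unfolding Bseq_def by auto
  have "\<phi> n \<le> C * real n powr (-3/2)" if "n > 0" for n
  proof -
    have "\<phi> n * real n powr (3/2) \<le> C" using C[of n] by linarith
    hence "\<phi> n * real n powr (3/2) * real n powr (-3/2) \<le> C * real n powr (-3/2)"
      by (rule mult_right_mono) simp
    thus ?thesis using that by (simp add: mult.assoc powr_add [symmetric])
  qed
  thus ?thesis using that unfolding \<phi>_def by blast
qed

subsection \<open>Exponential series twisted by a character\<close>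

lemma summable_lorentz:
  fixes b c s :: real
  assumes "c > 0"
  shows "summable (\<lambda>n. 2 * s / (s\<^sup>2 + (c * (real n + b))\<^sup>2))"
proof (rule summable_comparison_test_bigo)
  show "summable (\<lambda>n. norm (1 / real n ^ 2))"
    using inverse_power_summable[of 2, where ?'a = real] by (simp add: inverse_eq_divide)
  show "(\<lambda>n. 2 * s / (s\<^sup>2 + (c * (real n + b))\<^sup>2)) \<in> O(\<lambda>n. 1 / real n ^ 2)"
    using assms by real_asymp
qed

context primitive_char
begin

lemma chi_0: "q \<noteq> 1 \<Longrightarrow> chi 0 = 0"
  using chi_nz_iff[of 0] by auto

text \<open>Fourier inversion writes the coefficients as combinations of powers of roots of unity,
  which leaves \<open>q\<close> geometric series.\<close>

lemma chi_power_sums: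
  fixes X :: complex
  assumes "even_character q chi" "norm X < 1"
  shows "(\<lambda>m. of_nat q * (chi m * X ^ m)) sums
           (gauss_sum q chi * (\<Sum>h<q. cnj (chi h) * (1 / (1 - unity_root q h * X))))"
proof -
  have "norm (unity_root q h * X) < 1" for h
    using assms(2) by (simp add: unity_root_def norm_mult)
  hence "(\<lambda>m. gauss_sum q chi * (\<Sum>h<q. cnj (chi h) * (unity_root q h * X) ^ m)) sums
           (gauss_sum q chi * (\<Sum>h<q. cnj (chi h) * (1 / (1 - unity_root q h * X))))"
    by (intro sums_mult sums_sum geometric_sums)
  moreover have "gauss_sum q chi * (\<Sum>h<q. cnj (chi h) * (unity_root q h * X) ^ m) =
                 of_nat q * (chi m * X ^ m)" for m
  proof -
    have "of_nat q * (chi m * X ^ m) =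
            gauss_sum q chi * (\<Sum>h<q. cnj (chi h) * unity_root q (m * h)) * X ^ m"
      using fourier_inversion[OF assms(1), of m] by (simp add: mult_ac)
    also have "\<dots> = gauss_sum q chi * (\<Sum>h<q. cnj (chi h) * (unity_root q h * X) ^ m)"
      unfolding mult.assoc sum_distrib_right mult.commute[of m]
      by (simp add: unity_root_mult power_mult_distrib mult_ac)
    finally show ?thesis ..
  qed
  ultimately show ?thesis by simp
qed

text \<open>As \<open>T\<close> need not be periodic, the index \<open>0\<close> has to drop out,
  which it does by \<open>chi 0 = 0\<close>; the map \<open>h\<close> to \<open>q - h\<close> then
  permutes the rest and evenness preserves the coefficients.\<close>

lemma sum_cnj_chi_reflect:
  assumes "even_character q chi" "q \<noteq> 1"
  shows "(\<Sum>h<q. cnj (chi h) * T (q - h)) = (\<Sum>h<q. cnj (chi h) * T h)"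
proof -
  have split: "(\<Sum>h<q. cnj (chi h) * U h) = (\<Sum>h\<in>{1..<q}. cnj (chi h) * U h)" for U
    by (rule sum.mono_neutral_right) (use chi_0[OF assms(2)] in \<open>auto simp: not_le\<close>)
  have refl: "chi (q - h) = chi h" if "h \<in> {1..<q}" for h
  proof -
    have "(q - 1) * h = (h - 1) * q + (q - h)"
      using that by (cases h; cases q) (auto simp: algebra_simps)
    hence "[(q - 1) * h = q - h] (mod q)" by (simp add: cong_def)
    hence "chi (q - h) = chi ((q - 1) * h)" by (rule chi_cong [symmetric])
    thus ?thesis using assms(1) by (simp add: chi_mult even_character_def)
  qed
  have "(\<Sum>h\<in>{1..<q}. cnj (chi h) * T (q - h)) = (\<Sum>h\<in>{1..<q}. cnj (chi h) * T h)"
    by (rule sum.reindex_bij_witness[of _ "\<lambda>h. q - h" "\<lambda>h. q - h"]) (auto simp: refl)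
  thus ?thesis by (simp only: split)
qed

text \<open>Here the summand is periodic in \<open>h\<close>, so \<open>-h\<close> may replace
  \<open>h\<close> modulo \<open>q\<close>; this inverts the root and fixes the even
  character.\<close>

lemma sum_cnj_chi_conj_root:
  assumes "even_character q chi"
  shows "(\<Sum>h<q. cnj (chi h) * (1 / (1 - exp (- 2 * of_real pi * \<i> * of_nat h / of_nat q) * X))) =
         (\<Sum>h<q. cnj (chi h) * (1 / (1 - unity_root q h * X)))"
proof -
  let ?f = "\<lambda>h. cnj (chi h) * (1 / (1 - unity_root q h * X))"
  have "coprime (q - 1) q"
    using assms chi_nz_iff[of "q - 1"] by (simp add: even_character_def)
  hence "(\<Sum>h<q. ?f ((q - 1) * h)) = (\<Sum>h<q. ?f h)"
    by (intro sum_mult_coprime modulus_pos)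
       (simp_all add: chi_mod unity_root_cong[of "k mod q" k q for k])
  moreover have "?f ((q - 1) * h) =
      cnj (chi h) * (1 / (1 - exp (- 2 * of_real pi * \<i> * of_nat h / of_nat q) * X))" for h
  proof -
    have "(q - 1) * h + h = q * h" using modulus_pos by (simp add: algebra_simps)
    hence "unity_root q ((q - 1) * h) * unity_root q h = 1"
      using modulus_pos by (simp add: unity_root_add [symmetric] unity_root_eq_1_iff)
    hence "unity_root q ((q - 1) * h) = inverse (unity_root q h)"
      by (metis inverse_unique mult.commute)
    also have "\<dots> = exp (- 2 * of_real pi * \<i> * of_nat h / of_nat q)"
      by (simp add: unity_root_def exp_minus [symmetric])
    finally show ?thesis
      using assms by (simp add: chi_mult even_character_def)
  qed
  ultimately show ?thesis by (simp only:)
qed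

text \<open>By evenness the sums with \<open>R\<close> and with its conjugate-root version
  \<open>R'\<close> agree, so twice the first is a sum over \<open>R h + R' h - 1\<close>, the
  \<open>-1\<close> contributing nothing. The partial fractions turn this into
  \<open>T h + T (q - h)\<close>, and reflection yields twice \<open>N\<close>.\<close>

lemma char_exp_series:
  fixes s :: real
  assumes even: "even_character q chi" and q: "q \<noteq> 1" and s: "s > 0"
  shows "(\<Sum>j. chi (Suc j) * of_real (exp (- real (Suc j) * s))) =
         gauss_sum q chi / of_nat q *
           (\<Sum>j. cnj (chi (Suc j)) * of_real (2 * s / (s\<^sup>2 + (2 * pi * real (Suc j) / real q)\<^sup>2)))"
proof -
  define X :: complex where "X = of_real (exp (- s))"
  define L where "L = (\<lambda>r. 2 * s / (s\<^sup>2 + (2 * pi * r)\<^sup>2))"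
  define T :: "nat \<Rightarrow> complex" where "T = (\<lambda>h. \<Sum>k. of_real (L (real k + real h / real q)))"
  define N where "N = (\<Sum>n. cnj (chi n) * of_real (L (real n / real q)))"
  define \<tau> where "\<tau> = gauss_sum q chi"
  have q0: "real q > 0" using modulus_pos by simp
  have norm_X: "norm X < 1" using s by (simp add: X_def)
  have L_nonneg: "L r \<ge> 0" for r
    unfolding L_def using s by (intro divide_nonneg_nonneg add_nonneg_nonneg) auto
  have T: "(\<lambda>k. of_real (L (real k + real h / real q))) sums T h" for h
    unfolding T_def L_def by (intro summable_sums summable_of_real summable_lorentz) simp

  have "summable (\<lambda>n. L (real n / real q))"
    using summable_lorentz[of "2 * pi / real q" s 0] q0 by (simp add: L_def)
  hence "summable (\<lambda>n. cnj (chi n) * of_real (L (real n / real q)))"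
    by (rule summable_comparison_test'[where N = 0])
       (auto simp: norm_mult norm_chi_le L_nonneg intro!: mult_left_le_one_le)
  hence N: "(\<lambda>n. cnj (chi n) * of_real (L (real n / real q))) sums N"
    unfolding N_def by (rule summable_sums)
  \<comment> \<open>The series \<open>N\<close> is cut into blocks of length \<open>q\<close> by
    writing \<open>n = k * q + h\<close>.\<close>
  have "(\<lambda>k. \<Sum>h<q. cnj (chi h) * of_real (L (real k + real h / real q))) sums N"
  proof -
    have "(\<Sum>n\<in>{k * q..<k * q + q}. cnj (chi n) * of_real (L (real n / real q))) =
          (\<Sum>h<q. cnj (chi h) * of_real (L (real k + real h / real q)))" for k
    proof -
      have "(\<Sum>n\<in>{k * q..<k * q + q}. cnj (chi n) * of_real (L (real n / real q))) =
            (\<Sum>h\<in>{0..<q}. cnj (chi (h + k * q)) * of_real (L (real (h + k * q) / real q)))"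
        using sum.shift_bounds_nat_ivl[of "\<lambda>n. cnj (chi n) * of_real (L (real n / real q))" 0 "k * q" q]
        by (simp add: add.commute)
      also have "\<dots> = (\<Sum>h<q. cnj (chi h) * of_real (L (real k + real h / real q)))"
      proof (rule sum.cong)
        fix h
        have "chi (h + k * q) = chi h" by (rule chi_cong) (simp add: cong_def)
        moreover have "real (h + k * q) / real q = real k + real h / real q"
          using q0 by (simp add: field_simps)
        ultimately show "cnj (chi (h + k * q)) * of_real (L (real (h + k * q) / real q)) =
               cnj (chi h) * of_real (L (real k + real h / real q))" by simp
      qed auto
      finally show ?thesis .
    qed
    with sums_group[OF N modulus_pos] show ?thesis by simp
  qed
  moreover have "(\<lambda>k. \<Sum>h<q. cnj (chi h) * of_real (L (real k + real h / real q))) sums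
                   (\<Sum>h<q. cnj (chi h) * T h)"
    by (intro sums_sum sums_mult T)
  ultimately have TN: "(\<Sum>h<q. cnj (chi h) * T h) = N"
    using sums_unique2 by blast

  define R R' where "R = (\<lambda>h. 1 / (1 - unity_root q h * X))"
    and "R' = (\<lambda>h. 1 / (1 - exp (- 2 * of_real pi * \<i> * of_nat h / of_nat q) * X))"
  have RT: "R h + R' h - 1 = T h + T (q - h)" if "h < q" for h
  proof -
    have "(\<lambda>k. of_real (L (real k + real h / real q) + L (real (Suc k) - real h / real q))) sums
          (R h + R' h - 1)"
      using lorentz_pfd[OF s, of "real h / real q"]
      by (simp add: L_def R_def R'_def unity_root_def X_def exp_diff exp_minus exp_of_real [symmetric]
            divide_inverse mult_ac)
    moreover have "real (Suc k) - real h / real q = real k + real (q - h) / real q" for k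
      using that q0 by (simp add: of_nat_diff field_simps)
    ultimately have "(\<lambda>k. of_real (L (real k + real h / real q)) +
            of_real (L (real k + real (q - h) / real q))) sums (R h + R' h - 1)"
      by (simp del: of_nat_Suc)
    with sums_add[OF T[of h] T[of "q - h"]] show ?thesis
      using sums_unique2 by blast
  qed

  \<comment> \<open>Fourier inversion at \<open>m = 0\<close>, where the left side is
    \<open>q * chi 0 = 0\<close>.\<close>
  have zero: "\<tau> * (\<Sum>h<q. cnj (chi h)) = 0"
    using fourier_inversion[OF even, of 0] chi_0[OF q] by (simp add: \<tau>_def unity_root_def)
  have "2 * (\<tau> * (\<Sum>h<q. cnj (chi h) * R h)) =
          \<tau> * ((\<Sum>h<q. cnj (chi h) * R h) + (\<Sum>h<q. cnj (chi h) * R' h)) - \<tau> * (\<Sum>h<q. cnj (chi h))"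
    unfolding zero using sum_cnj_chi_conj_root[OF even, of X] by (simp add: R_def R'_def)
  also have "\<dots> = \<tau> * (\<Sum>h<q. cnj (chi h) * (R h + R' h - 1))"
    by (simp add: algebra_simps sum.distrib sum_subtractf)
  also have "(\<Sum>h<q. cnj (chi h) * (R h + R' h - 1)) = (\<Sum>h<q. cnj (chi h) * (T h + T (q - h)))"
    by (intro sum.cong) (auto simp: RT)
  also have "\<dots> = (\<Sum>h<q. cnj (chi h) * T h) + (\<Sum>h<q. cnj (chi h) * T (q - h))"
    by (simp add: algebra_simps sum.distrib)
  also have "\<dots> = 2 * N"
    by (simp add: sum_cnj_chi_reflect[OF even q] TN)
  finally have RN: "\<tau> * (\<Sum>h<q. cnj (chi h) * R h) = \<tau> * N" by simp

  have "(\<lambda>m. of_nat q * (chi m * X ^ m)) sums (\<tau> * N)"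
    using chi_power_sums[OF even norm_X] RN unfolding \<tau>_def R_def by (simp only:)
  hence "(\<lambda>m. of_nat q * (chi m * X ^ m) / of_nat q) sums (\<tau> * N / of_nat q)"
    by (rule sums_divide)
  hence "(\<lambda>m. chi m * X ^ m) sums (\<tau> * N / of_nat q)"
    using modulus_pos by simp
  hence "(\<lambda>j. chi (Suc j) * X ^ Suc j) sums (\<tau> * N / of_nat q)"
    by (subst sums_Suc_iff) (simp add: chi_0[OF q])
  moreover have "X ^ n = of_real (exp (- real n * s))" for n
    by (simp add: X_def exp_of_nat_mult [symmetric] of_real_power [symmetric] del: of_real_power)
  ultimately have "(\<Sum>j. chi (Suc j) * of_real (exp (- real (Suc j) * s))) = \<tau> * N / of_nat q"
    by (simp add: sums_iff del: power_Suc of_nat_Suc)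
  moreover have "(\<lambda>j. cnj (chi (Suc j)) * of_real (L (real (Suc j) / real q))) sums N"
    using N by (subst sums_Suc_iff) (simp add: chi_0[OF q])
  hence "N = (\<Sum>j. cnj (chi (Suc j)) * of_real (L (real (Suc j) / real q)))"
    by (rule sums_unique)
  ultimately show ?thesis by (simp add: \<tau>_def L_def)
qed

end

section \<open>Comparison of the two evaluations\<close>

lemma primitive_charI: "primitive_character q chi \<Longrightarrow> primitive_char q chi"
  by unfold_locales (auto simp: primitive_character_def)

text \<open>Non-principality enters in this form: it gives \<open>chi 0 = 0\<close>, so series may
  start at index 1.\<close>

lemma (in dirichlet_char) modulus_neq_1:
  assumes "\<not> principal_character q chi"
  shows "q \<noteq> 1"
proof
  assume "q = 1"
  hence "chi n = 1" for n using chi_cong[of n 1] chi_1 by (simp add: cong_def)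
  with assms show False by (simp add: principal_character_def)
qed

text \<open>Both sides are genuinely convergent series: \<open>I_sums\<close> and
  \<open>J_sums\<close> establish this along with their values.\<close>

theorem theorem2p14:
  fixes chi1 chi2 :: "nat \<Rightarrow> complex" and p q :: nat and a x :: real
  assumes "primitive_character p chi1" and "\<not> principal_character p chi1" and "even_character p chi1"
    and "primitive_character q chi2" and "\<not> principal_character q chi2" and "even_character q chi2"
    and "a > 0" and "x > 0"
    and "\<not> (\<exists>k::nat. k > 0 \<and> a\<^sup>2 * p * q * x / (16 * pi\<^sup>2) = real k)"
  shows "(\<Sum>n. twisted_divisor chi1 chi2 (Suc n) * of_real (bessel_K0 (a * sqrt (real (Suc n) * x))))
       = of_real (a\<^sup>2 * p * q * x / (32 * pi ^ 4)) * gauss_sum p chi1 * gauss_sum q chi2 *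
         (\<Sum>n. twisted_divisor (\<lambda>m. cnj (chi1 m)) (\<lambda>m. cnj (chi2 m)) (Suc n) *
            of_real (ln (16 * pi\<^sup>2 * real (Suc n) / (a\<^sup>2 * p * q * x))
                     / ((real (Suc n))\<^sup>2 - (a\<^sup>2 * p * q * x / (16 * pi\<^sup>2))\<^sup>2)))"
proof -
  interpret chi1: primitive_char p chi1 by (rule primitive_charI) fact
  interpret chi2: primitive_char q chi2 by (rule primitive_charI) fact
  note neq1 = chi1.modulus_neq_1[OF assms(2)] chi2.modulus_neq_1[OF assms(5)]
  have pq: "real p > 0" "real q > 0" using chi1.modulus_pos chi2.modulus_pos by auto
  \<comment> \<open>Makes \<open>2 * \<alpha> * sqrt n\<close> the Bessel argument
    \<open>a * sqrt (n * x)\<close>.\<close>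
  define \<alpha> where "\<alpha> = a * sqrt x / 2"
  have \<alpha>: "\<alpha> > 0" using assms by (simp add: \<alpha>_def)
  have \<alpha>2: "\<alpha>\<^sup>2 = a\<^sup>2 * x / 4" using assms by (simp add: \<alpha>_def power_divide power_mult_distrib)
  \<comment> \<open>For \<open>A = 2 pi j / p\<close> and \<open>B = 2 pi k / q\<close> the product
    \<open>A * B\<close> is \<open>c * (j * k)\<close>. It equals the square of \<alpha> precisely
    when \<open>j * k\<close> equals \<open>y\<close> below, the case excluded by
    hypothesis.\<close>
  define c where "c = 4 * pi\<^sup>2 / (real p * real q)"
  have c: "c > 0" using pq by (simp add: c_def)
  define y where "y = a\<^sup>2 * p * q * x / (16 * pi\<^sup>2)"
  have y: "\<alpha>\<^sup>2 = c * y" using pq by (simp add: \<alpha>2 c_def y_def)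
  have y_neq: "real n \<noteq> y" if "n > 0" for n :: nat
    using assms(9) that unfolding y_def by metis
  define \<phi> where "\<phi> = (\<lambda>n. 4 * \<alpha>\<^sup>2 * ln (c * real n / \<alpha>\<^sup>2) / ((c * real n)\<^sup>2 - \<alpha> ^ 4))"

  define I where "I = (\<integral>s. (\<Sum>j. chi1 (Suc j) * of_real (exp (- real (Suc j) * (\<alpha> * exp s)))) *
                        (\<Sum>k. chi2 (Suc k) * of_real (exp (- real (Suc k) * (\<alpha> * exp (- s))))) \<partial>lborel)"
  define J where "J = (\<integral>s. (\<Sum>j. cnj (chi1 (Suc j)) *
                          of_real (2 * (\<alpha> * exp s) / ((\<alpha> * exp s)\<^sup>2 + (2 * pi * real (Suc j) / real p)\<^sup>2))) *
                        (\<Sum>k. cnj (chi2 (Suc k)) *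
                          of_real (2 * (\<alpha> * exp (- s)) / ((\<alpha> * exp (- s))\<^sup>2 + (2 * pi * real (Suc k) / real q)\<^sup>2)))
                      \<partial>lborel)"

  have I_sums: "(\<lambda>n. twisted_divisor chi1 chi2 (Suc n) * of_real (2 * bessel_K0 (2 * \<alpha> * sqrt (real (Suc n))))) sums I"
    unfolding I_def
  proof (rule twisted_divisor_sums_integral)
    show "has_bochner_integral lborel
        (\<lambda>s. exp (- real (Suc j) * (\<alpha> * exp s)) * exp (- real (Suc k) * (\<alpha> * exp (- s))))
        (2 * bessel_K0 (2 * \<alpha> * sqrt (real (Suc j * Suc k))))" for j k
      using has_bochner_integral_bessel_K0[OF \<alpha>, of "real (Suc j)" "real (Suc k)"]
      by (simp only: of_nat_mult)
    have summable: "summable (\<lambda>j. exp (- real (Suc j) * y))" if "y > 0" for y :: real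
    proof -
      have "summable (\<lambda>j. exp (- y) * exp (- y) ^ j)"
        using that by (intro summable_mult summable_geometric) simp
      also have "(\<lambda>j. exp (- y) * exp (- y) ^ j) = (\<lambda>j. exp (- real (Suc j) * y))"
        by (auto simp: exp_of_nat_mult [symmetric] exp_add [symmetric] algebra_simps)
      finally show ?thesis .
    qed
    show "summable (\<lambda>j. exp (- real (Suc j) * (\<alpha> * exp s)))" for s
      by (rule summable) (use \<alpha> in simp)
    show "summable (\<lambda>k. exp (- real (Suc k) * (\<alpha> * exp (- s))))" for s
      by (rule summable) (use \<alpha> in simp)
    \<comment> \<open>The constant is \<open>2 * 12 / 2 ^ 3 = 3\<close>.\<close>
    show "2 * bessel_K0 (2 * \<alpha> * sqrt (real n)) \<le> 3 / \<alpha> ^ 3 * real n powr (- 3 / 2)" if "n > 0" for n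
    proof -
      have "sqrt (real n) ^ 3 = real n powr (3 / 2)"
        using that by (simp add: powr_half_sqrt [symmetric] powr_power)
      moreover have "2 * bessel_K0 (2 * \<alpha> * sqrt (real n)) \<le> 2 * (12 / (2 * \<alpha> * sqrt (real n)) ^ 3)"
        using that \<alpha> by (intro mult_left_mono bessel_K0_le) auto
      ultimately show ?thesis
        using that \<alpha> by (simp add: power_mult_distrib powr_minus field_simps)
    qed
  qed (use chi1.norm_chi_le chi2.norm_chi_le in auto)

  obtain C where C: "\<And>n. n > 0 \<Longrightarrow> \<phi> n \<le> C * real n powr (-3/2)"
    using log_ratio_bound[OF c \<alpha>] unfolding \<phi>_def by blast
  have J_sums: "(\<lambda>n. twisted_divisor (\<lambda>m. cnj (chi1 m)) (\<lambda>m. cnj (chi2 m)) (Suc n) * of_real (\<phi> (Suc n))) sums J"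
    unfolding J_def
  proof (rule twisted_divisor_sums_integral)
    fix j k
    let ?A = "2 * pi * real (Suc j) / real p" and ?B = "2 * pi * real (Suc k) / real q"
    have AB: "?A * ?B = c * real (Suc j * Suc k)"
      by (simp add: c_def power2_eq_square del: of_nat_Suc mult_Suc mult_Suc_right)
    have "?A * ?B \<noteq> \<alpha>\<^sup>2"
      unfolding AB y using y_neq[of "Suc j * Suc k"] c by (simp del: of_nat_mult of_nat_Suc mult_Suc mult_Suc_right)
    moreover have "?A > 0" "?B > 0" using pq by simp_all
    ultimately show "has_bochner_integral lborel
        (\<lambda>s. 2 * (\<alpha> * exp s) / ((\<alpha> * exp s)\<^sup>2 + ?A\<^sup>2) * (2 * (\<alpha> * exp (- s)) / ((\<alpha> * exp (- s))\<^sup>2 + ?B\<^sup>2)))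
        (\<phi> (Suc j * Suc k))"
      using has_bochner_integral_lorentz_prod[OF \<alpha>, of ?A ?B] unfolding \<phi>_def AB by blast
  next
    show "summable (\<lambda>j. 2 * (\<alpha> * exp s) / ((\<alpha> * exp s)\<^sup>2 + (2 * pi * real (Suc j) / real p)\<^sup>2))" for s
      using summable_lorentz[of "2 * pi / real p" "\<alpha> * exp s" 1] pq by (simp add: add.commute)
    show "summable (\<lambda>j. 2 * (\<alpha> * exp (- s)) / ((\<alpha> * exp (- s))\<^sup>2 + (2 * pi * real (Suc j) / real q)\<^sup>2))" for s
      using summable_lorentz[of "2 * pi / real q" "\<alpha> * exp (- s)" 1] pq by (simp add: add.commute)
    show "\<phi> n \<le> C * real n powr (-3/2)" if "n > 0" for n using C[OF that] .
  qed (use \<alpha> chi1.norm_chi_le chi2.norm_chi_le in \<open>auto intro!: divide_nonneg_nonneg add_nonneg_nonneg\<close>)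

  \<comment> \<open>The character expansions are inserted under the integral at the positive points
    \<open>\<alpha> * exp s\<close> and \<open>\<alpha> * exp (- s)\<close>.\<close>
  have I_eq_J: "I = (gauss_sum p chi1 / of_nat p) * (gauss_sum q chi2 / of_nat q) * J"
    unfolding I_def J_def Bochner_Integration.integral_mult_right_zero [symmetric]
    using \<alpha> by (intro Bochner_Integration.integral_cong refl)
      (simp only: chi1.char_exp_series[OF assms(3) neq1(1)] chi2.char_exp_series[OF assms(6) neq1(2)]
         mult_pos_pos exp_gt_zero, simp only: mult_ac)

  have \<phi>_eq: "\<phi> n = 4 * \<alpha>\<^sup>2 / c\<^sup>2 *
      (ln (16 * pi\<^sup>2 * real n / (a\<^sup>2 * p * q * x)) / ((real n)\<^sup>2 - y\<^sup>2))" for n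
  proof -
    have "c * real n / \<alpha>\<^sup>2 = 16 * pi\<^sup>2 * real n / (a\<^sup>2 * p * q * x)"
      using c by (simp add: y y_def mult_ac)
    moreover have "(c * real n)\<^sup>2 - \<alpha> ^ 4 = c\<^sup>2 * ((real n)\<^sup>2 - y\<^sup>2)"
    proof -
      have "\<alpha> ^ 4 = (\<alpha>\<^sup>2)\<^sup>2" by simp
      thus ?thesis by (simp add: y power_mult_distrib algebra_simps)
    qed
    ultimately show ?thesis by (simp add: \<phi>_def)
  qed
  have "(\<lambda>n. twisted_divisor (\<lambda>m. cnj (chi1 m)) (\<lambda>m. cnj (chi2 m)) (Suc n) * of_real (\<phi> (Suc n)) / of_real (4 * \<alpha>\<^sup>2 / c\<^sup>2))
           sums (J / of_real (4 * \<alpha>\<^sup>2 / c\<^sup>2))"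
    by (intro sums_divide J_sums)
  hence rhs: "(\<Sum>n. twisted_divisor (\<lambda>m. cnj (chi1 m)) (\<lambda>m. cnj (chi2 m)) (Suc n) *
            of_real (ln (16 * pi\<^sup>2 * real (Suc n) / (a\<^sup>2 * p * q * x)) / ((real (Suc n))\<^sup>2 - y\<^sup>2))) =
         J / of_real (4 * \<alpha>\<^sup>2 / c\<^sup>2)"
    using \<alpha> c by (simp add: sums_iff \<phi>_eq del: of_nat_Suc)

  have "(\<lambda>n. twisted_divisor chi1 chi2 (Suc n) * of_real (2 * bessel_K0 (2 * \<alpha> * sqrt (real (Suc n)))) / 2) sums (I / 2)"
    by (intro sums_divide I_sums)
  moreover have "2 * \<alpha> * sqrt (real n) = a * sqrt (real n * x)" for n
    by (simp add: \<alpha>_def real_sqrt_mult mult_ac)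
  ultimately have lhs: "(\<Sum>n. twisted_divisor chi1 chi2 (Suc n) * of_real (bessel_K0 (a * sqrt (real (Suc n) * x)))) = I / 2"
    by (simp add: sums_iff del: of_nat_Suc)

  \<comment> \<open>The factor relating \<open>J\<close> to the logarithmic series, times
    \<open>1 / (p q)\<close> from the two expansions and \<open>1 / 2\<close> from the doubled
    Bessel function.\<close>
  have const: "a\<^sup>2 * p * q * x / (32 * pi ^ 4) = 4 * \<alpha>\<^sup>2 / c\<^sup>2 / (2 * real p * real q)"
    unfolding \<alpha>2 c_def using pq by (simp add: field_simps power2_eq_square power4_eq_xxxx)
  show ?thesis
    unfolding lhs rhs[unfolded y_def] const I_eq_J
    using \<alpha> c pq by (simp add: field_simps)
qed

end
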